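(* Let $k$ be a field of characteristic $p>0$, let $V$ be a finite-dimensional $k$-vector space, and let $m$ be a positive integer divisible by $p$. Let $N_m(V)$ be the complex $$0\to S_m(V)\to S_{(m-1,1)}(V)\to\cdots\to S_{(m-i,1^i)}(V)\to\cdots\to\bigwedge^mV\to0$$ whose differentials are induced by the map $\phi$ (see context). Then the differentials of $N_m(V)$ are $\mathrm{GL}(V)$-equivariant.
   Context: Hook Schur modules: let $\kappa_{a,b}:\bigwedge^bV\otimes S_a(V)\to\bigwedge^{b-1}V\otimes S_{a+1}(V)$ be the Koszul map (exterior comultiplication $\bigwedge^bV\to\bigwedge^{b-1}V\otimes V$ followed by symmetric multiplication). For $a\ge1$, $b\ge0$, $S_{(a,1^b)}(V)=\ker\kappa_{a,b}=\operatorname{im}\kappa_{a-1,b+1}\cong\operatorname{coker}\kappa_{a-2,b+2}$, viewed as a quotient of $\bigwedge^{b+1}V\otimes S_{a-1}(V)$, with its natural $\mathrm{GL}(V)$-action. The map $\phi:\bigwedge^rV\otimes S_j(V)\to\bigwedge^{r+1}V\otimes S_{j-1}(V)$ is symmetric comultiplication $S_j(V)\to V\otimes S_{j-1}(V)$ followed by exterior multiplication. In a basis $v_1,\dots,v_n$ of $V$, with $v_I=v_{\ell_1}\wedge\cdots\wedge v_{\ell_r}$, $v^\alpha=v_1^{\alpha_1}\cdots v_n^{\alpha_n}$ and $\epsilon_t$ the $t$-th standard vector, $\phi(v_I\otimes v^\alpha)=\sum_{t=1}^n\alpha_t\,v_I\wedge v_t\otimes v^{\alpha-\epsilon_t}$.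 When $p\mid m$, $\phi:\bigwedge^{i+1}V\otimes S_{m-i-1}(V)\to\bigwedge^{i+2}V\otimes S_{m-i-2}(V)$ descends to a well-defined map $S_{(m-i,1^i)}(V)\to S_{(m-i-1,1^{i+1})}(V)$, which is the differential of $N_m(V)$. *)

theory Defs
  imports
    "HOL-Library.Poly_Mapping"
    "HOL-Library.Set_Algebras"
    "HOL-Computational_Algebra.Computational_Algebra"
begin

text \<open>
  The ground field is the type \<open>'k\<close> and \<open>V\<close> is the type \<open>'v\<close> with scalar multiplication \<open>s\<close>.
  The space \<open>'w \<Rightarrow>\<^sub>0 'k\<close> is the free vector space on \<open>'w\<close>. A pair of lists
  \<open>([w\<^sub>1,\<dots>,w\<^sub>b], [u\<^sub>1,\<dots>,u\<^sub>a])\<close> stands for the generator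
  \<open>(w\<^sub>1 \<and> \<dots> \<and> w\<^sub>b) \<otimes> (u\<^sub>1 \<cdots> u\<^sub>a)\<close> of \<open>\<And>\<^sup>b V \<otimes> S\<^sub>a V\<close>.
\<close>

type_synonym ('v, 'k) words = "('v list \<times> 'v list) \<Rightarrow>\<^sub>0 'k"

definition fscale :: "'k::field \<Rightarrow> ('w \<Rightarrow>\<^sub>0 'k) \<Rightarrow> ('w \<Rightarrow>\<^sub>0 'k)" where
  "fscale c x = Poly_Mapping.map ((*) c) x"

definition linear_ext :: "('w \<Rightarrow> ('u \<Rightarrow>\<^sub>0 'k::field)) \<Rightarrow> ('w \<Rightarrow>\<^sub>0 'k) \<Rightarrow> ('u \<Rightarrow>\<^sub>0 'k)" where
  "linear_ext f x = (\<Sum>w\<in>Poly_Mapping.keys x. fscale (Poly_Mapping.lookup x w) (f w))"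

abbreviation word :: "'v list \<Rightarrow> 'v list \<Rightarrow> ('v, 'k::field) words" where
  "word ws us \<equiv> Poly_Mapping.single (ws, us) 1"

text \<open>
  \<open>\<And>V \<otimes> SV\<close> is the quotient of the free space on all pairs of lists by the following relations:
  multilinearity in every slot, \<open>x \<and> x = 0\<close> (adjacent slots, as in the quotient of the tensor
  algebra by the ideal generated by all \<open>x \<otimes> x\<close>), and \<open>x y = y x\<close> in the symmetric factor.
  All relations are homogeneous for the bigrading by the two lengths.
\<close>

inductive_set relators :: "('k::field \<Rightarrow> 'v::ab_group_add \<Rightarrow> 'v) \<Rightarrow> ('v, 'k) words set"
  for s :: "'k \<Rightarrow> 'v \<Rightarrow> 'v"
  where
    wedge_add: "word (A @ [x + y] @ B) us - word (A @ [x] @ B) us - word (A @ [y] @ B) us \<in> relators s"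
  | wedge_scale: "word (A @ [s c x] @ B) us - fscale c (word (A @ [x] @ B) us) \<in> relators s"
  | wedge_alt: "word (A @ [x, x] @ B) us \<in> relators s"
  | sym_add: "word ws (A @ [x + y] @ B) - word ws (A @ [x] @ B) - word ws (A @ [y] @ B) \<in> relators s"
  | sym_scale: "word ws (A @ [s c x] @ B) - fscale c (word ws (A @ [x] @ B)) \<in> relators s"
  | sym_comm: "word ws (A @ [x, y] @ B) - word ws (A @ [y, x] @ B) \<in> relators s"

definition rel_space :: "('k::field \<Rightarrow> 'v::ab_group_add \<Rightarrow> 'v) \<Rightarrow> ('v, 'k) words set" where
  "rel_space s = module.span fscale (relators s)"

text \<open>
  Degrees are integers, so that the pieces of negative degree are zero; in particular
  \<open>S\<^sub>-\<^sub>1 V = 0\<close>, as needed for the cokernel of \<open>\<kappa>\<^bsub>-1,b+2\<^esub>\<close>.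
\<close>

definition word_space :: "int \<Rightarrow> int \<Rightarrow> ('v, 'k::field) words set" where
  "word_space b a =
    {x. \<forall>(ws, us) \<in> Poly_Mapping.keys x. int (length ws) = b \<and> int (length us) = a}"

text \<open>The space \<open>\<And>\<^sup>b V \<otimes> S\<^sub>a V\<close>; its elements are cosets of \<open>rel_space s\<close>.\<close>

definition ext_sym :: "('k::field \<Rightarrow> 'v::ab_group_add \<Rightarrow> 'v) \<Rightarrow> int \<Rightarrow> int \<Rightarrow> ('v, 'k) words set set" where
  "ext_sym s b a = (\<lambda>x. x +o rel_space s) ` word_space b a"

text \<open>
  The map induced on cosets by \<open>f\<close>, where \<open>U\<close> is the subspace divided out in the target. No
  representative is chosen: for a coset \<open>X = x + U'\<close> and additive \<open>f\<close>, the set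
  \<open>f ` X + U = f x + (f ` U' + U)\<close> is a coset of \<open>U\<close> exactly if \<open>f ` U' \<subseteq> U\<close>, that is, if \<open>f\<close>
  descends.
\<close>

definition induced :: "('x \<Rightarrow> 'y::plus) \<Rightarrow> 'y set \<Rightarrow> 'x set \<Rightarrow> 'y set" where
  "induced f U X = f ` X + U"

text \<open>
  Koszul map: the comultiplication \<open>\<And>\<^sup>b V \<rightarrow> \<And>\<^sup>b\<^sup>-\<^sup>1 V \<otimes> V\<close> moves the factor with (0-based) index
  \<open>i\<close> to the far right, which costs the sign \<open>(-1)\<^bsup>b-1-i\<^esup>\<close>.
\<close>

definition koszul_word :: "'v list \<times> 'v list \<Rightarrow> ('v, 'k::field) words" where
  "koszul_word = (\<lambda>(ws, us). \<Sum>i<length ws.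
     Poly_Mapping.single (take i ws @ drop (Suc i) ws, ws ! i # us) ((- 1) ^ (length ws - 1 - i)))"

definition koszul :: "('k::field \<Rightarrow> 'v::ab_group_add \<Rightarrow> 'v) \<Rightarrow> ('v, 'k) words set \<Rightarrow> ('v, 'k) words set" where
  "koszul s = induced (linear_ext koszul_word) (rel_space s)"

text \<open>
  The map \<open>\<phi>\<close>. On a monomial \<open>v\<^sup>\<alpha>\<close> the factor \<open>v\<^sub>t\<close> is split off \<open>\<alpha>\<^sub>t\<close> times, which produces
  the coefficient \<open>\<alpha>\<^sub>t\<close>.
\<close>

definition phi_word :: "'v list \<times> 'v list \<Rightarrow> ('v, 'k::field) words" where
  "phi_word = (\<lambda>(ws, us). \<Sum>j<length us. word (ws @ [us ! j]) (take j us @ drop (Suc j) us))"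

definition phi :: "('k::field \<Rightarrow> 'v::ab_group_add \<Rightarrow> 'v) \<Rightarrow> ('v, 'k) words set \<Rightarrow> ('v, 'k) words set" where
  "phi s = induced (linear_ext phi_word) (rel_space s)"

definition GL :: "('k::field \<Rightarrow> 'v::ab_group_add \<Rightarrow> 'v) \<Rightarrow> ('v \<Rightarrow> 'v) set" where
  "GL s = {g. Vector_Spaces.linear s s g \<and> bij g}"

definition act_word :: "('v \<Rightarrow> 'v) \<Rightarrow> 'v list \<times> 'v list \<Rightarrow> ('v, 'k::field) words" where
  "act_word g = (\<lambda>(ws, us). word (map g ws) (map g us))"

definition act :: "('k::field \<Rightarrow> 'v::ab_group_add \<Rightarrow> 'v) \<Rightarrow> ('v \<Rightarrow> 'v) \<Rightarrow> ('v, 'k) words set \<Rightarrow> ('v, 'k) words set" where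
  "act s g = induced (linear_ext (act_word g)) (rel_space s)"

text \<open>
  \<open>S\<^bsub>(a,1^b)\<^esub>(V) = coker \<kappa>\<^bsub>a-2,b+2\<^esub>\<close> as a quotient of \<open>\<And>\<^sup>b\<^sup>+\<^sup>1 V \<otimes> S\<^sub>a\<^sub>-\<^sub>1 V\<close>. Its elements are cosets, in
  the space \<open>ext_sym s (b + 1) (a - 1)\<close>, of the image of \<open>\<kappa>\<close>; that space consists of sets itself, and
  the sum of two of its elements is the elementwise sum of sets.
\<close>

definition hook_rel :: "('k::field \<Rightarrow> 'v::ab_group_add \<Rightarrow> 'v) \<Rightarrow> int \<Rightarrow> int \<Rightarrow> ('v, 'k) words set set" where
  "hook_rel s a b = koszul s ` ext_sym s (b + 2) (a - 2)"

definition hook_schur :: "('k::field \<Rightarrow> 'v::ab_group_add \<Rightarrow> 'v) \<Rightarrow> int \<Rightarrow> int \<Rightarrow> ('v, 'k) words set set set" where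
  "hook_schur s a b = (\<lambda>X. X +o hook_rel s a b) ` ext_sym s (b + 1) (a - 1)"

definition hook_act ::
    "('k::field \<Rightarrow> 'v::ab_group_add \<Rightarrow> 'v) \<Rightarrow> int \<Rightarrow> int \<Rightarrow> ('v \<Rightarrow> 'v) \<Rightarrow>
     ('v, 'k) words set set \<Rightarrow> ('v, 'k) words set set" where
  "hook_act s a b g = induced (act s g) (hook_rel s a b)"

text \<open>The complex \<open>N\<^sub>m(V)\<close>: its term at position \<open>i\<close> (\<open>0 \<le> i < m\<close>) is \<open>S\<^bsub>(m-i,1^i)\<^esub>(V)\<close>.\<close>

definition N_term :: "('k::field \<Rightarrow> 'v::ab_group_add \<Rightarrow> 'v) \<Rightarrow> nat \<Rightarrow> nat \<Rightarrow> ('v, 'k) words set set set" where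
  "N_term s m i = hook_schur s (int m - int i) (int i)"

definition N_act ::
    "('k::field \<Rightarrow> 'v::ab_group_add \<Rightarrow> 'v) \<Rightarrow> nat \<Rightarrow> nat \<Rightarrow> ('v \<Rightarrow> 'v) \<Rightarrow>
     ('v, 'k) words set set \<Rightarrow> ('v, 'k) words set set" where
  "N_act s m i = hook_act s (int m - int i) (int i)"

definition N_diff ::
    "('k::field \<Rightarrow> 'v::ab_group_add \<Rightarrow> 'v) \<Rightarrow> nat \<Rightarrow> nat \<Rightarrow>
     ('v, 'k) words set set \<Rightarrow> ('v, 'k) words set set" where
  "N_diff s m i = induced (phi s) (hook_rel s (int m - int i - 1) (int i + 1))"

text \<open>Equivariance includes that \<open>f\<close> maps \<open>A\<close> to \<open>B\<close>; for an induced map this says it is well defined.\<close>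

definition equivariant ::
    "'g set \<Rightarrow> 'x set \<Rightarrow> ('g \<Rightarrow> 'x \<Rightarrow> 'x) \<Rightarrow> 'y set \<Rightarrow> ('g \<Rightarrow> 'y \<Rightarrow> 'y) \<Rightarrow> ('x \<Rightarrow> 'y) \<Rightarrow> bool" where
  "equivariant G A \<alpha> B \<beta> f \<longleftrightarrow>
     (\<forall>X\<in>A. f X \<in> B) \<and> (\<forall>g\<in>G. \<forall>X\<in>A. f (\<alpha> g X) = \<beta> g (f X))"

end

theory Submission
  imports Defs
begin

text \<open>
  Write \<open>\<phi>\<close>, \<open>\<kappa>\<close> and \<open>g\<close> for the linear maps given on words of letters by \<open>phi_word\<close>,
  \<open>koszul_word\<close> and \<open>act_word g\<close>. On words, \<open>g\<close> replaces letters while \<open>\<phi>\<close> and \<open>\<kappa>\<close> only move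
  them, so \<open>g\<close> commutes with both (\<open>phi_act\<close>, \<open>koszul_act\<close>). Equivariance of the differential is
  therefore inherited from the words once all maps are known to descend to the hook Schur modules,
  which are quotients in two steps.

  The first step divides by the multilinear, alternating and commutative relations. All three maps
  preserve them; this is a check on the generating relators (\<open>phi_rel_space\<close>,
  \<open>koszul_rel_space\<close>, \<open>act_rel_space\<close>).

  The second step divides by the image of \<open>\<kappa>\<close>. The action preserves this image because it commutes
  with \<open>\<kappa>\<close>. For \<open>\<phi>\<close> the reason is the homotopy identity \<open>\<phi> \<kappa> + \<kappa> \<phi> = b + a\<close> on
  \<open>\<And>\<^sup>b V \<otimes> S\<^sub>a V\<close> (\<open>homotopy_word\<close>): in the complex \<open>N\<^sub>m(V)\<close> one has \<open>b + a = m\<close>, which vanishes in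
  characteristic \<open>p\<close> dividing \<open>m\<close>, so that \<open>\<phi> \<kappa> = \<kappa> (- \<phi>)\<close> maps into the image of \<open>\<kappa>\<close>.

  The induced maps are given on sets of representatives. \<open>induced_coset\<close> shows that such a map sends
  the coset of \<open>x\<close> to the coset of its image, and is applied once for each step; the outcome for the
  complex is \<open>N_act_class\<close> and \<open>N_diff_class\<close>.
\<close>

section \<open>Linear maps on free vector spaces\<close>

lemma lookup_fscale [simp]: "Poly_Mapping.lookup (fscale c x) w = c * Poly_Mapping.lookup x w"
  by (simp add: fscale_def map.rep_eq when_def)

lemma fscale_single: "fscale c (Poly_Mapping.single w d) = Poly_Mapping.single w (c * d)"
  by (rule poly_mapping_eqI) (simp add: lookup_single when_def)

interpretation fscale: vector_space "fscale :: 'k::field \<Rightarrow> ('w \<Rightarrow>\<^sub>0 'k) \<Rightarrow> ('w \<Rightarrow>\<^sub>0 'k)"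
  by unfold_locales (auto intro!: poly_mapping_eqI simp: lookup_add algebra_simps)

lemma linear_ext_superset:
  assumes "finite S" "Poly_Mapping.keys x \<subseteq> S"
  shows "linear_ext f x = (\<Sum>w\<in>S. fscale (Poly_Mapping.lookup x w) (f w))"
  unfolding linear_ext_def
  by (rule sum.mono_neutral_left) (use assms in \<open>auto simp: in_keys_iff\<close>)

interpretation linear_ext: Vector_Spaces.linear fscale fscale
  "linear_ext f :: ('w \<Rightarrow>\<^sub>0 'k::field) \<Rightarrow> ('u \<Rightarrow>\<^sub>0 'k)" for f
proof unfold_locales
  fix x y :: "'w \<Rightarrow>\<^sub>0 'k" and c :: 'k
  let ?S = "Poly_Mapping.keys x \<union> Poly_Mapping.keys y"
  have *: "linear_ext f z = (\<Sum>w\<in>?S. fscale (Poly_Mapping.lookup z w) (f w))"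
    if "Poly_Mapping.keys z \<subseteq> ?S" for z
    using that by (intro linear_ext_superset) auto
  show "linear_ext f (x + y) = linear_ext f x + linear_ext f y"
    by (subst (1 2 3) *)
       (use keys_add[of x y] in
         \<open>auto simp: lookup_add fscale.scale_left_distrib sum.distrib\<close>)
  have "Poly_Mapping.keys (fscale c x) \<subseteq> ?S"
    by (auto simp: in_keys_iff)
  then show "linear_ext f (fscale c x) = fscale c (linear_ext f x)"
    by (subst (1 2) *) (auto simp: fscale.scale_sum_right)
qed

lemma linear_ext_single [simp]: "linear_ext f (Poly_Mapping.single w c) = fscale c (f w)"
  by (subst linear_ext_superset[of "{w}"]) auto

lemma linear_ext_linear_ext: "linear_ext f (linear_ext g x) = linear_ext (\<lambda>w. linear_ext f (g w)) x"
  by (simp add: linear_ext_def[of g] linear_ext_def[of "\<lambda>w. linear_ext f (g w)"]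
      linear_ext.sum linear_ext.scale)

lemma linear_ext_in_subspace:
  assumes "module.subspace fscale U" "\<And>w. w \<in> Poly_Mapping.keys x \<Longrightarrow> f w \<in> U"
  shows "linear_ext f x \<in> U"
  unfolding linear_ext_def
  using assms by (auto intro!: fscale.subspace_sum fscale.subspace_scale)

lemma linear_ext_add_maps: "linear_ext f x + linear_ext g x = linear_ext (\<lambda>w. f w + g w) x"
  by (simp add: linear_ext_def sum.distrib fscale.scale_right_distrib)

section \<open>Sums over the entries of a list\<close>

text \<open>
  Both \<open>koszul_word\<close> and \<open>phi_word\<close> remove one entry of a list in all possible ways. Summing over
  the splittings \<open>l @ [x] @ r\<close> of the list, instead of over positions, avoids index arithmetic:
  a relator singles out a piece of the list, and the sum decomposes along that piece.
\<close>

definition split_sum :: "('a list \<Rightarrow> 'a \<Rightarrow> 'a list \<Rightarrow> 'b::comm_monoid_add) \<Rightarrow> 'a list \<Rightarrow> 'b" where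
  "split_sum h xs = (\<Sum>i<length xs. h (take i xs) (xs ! i) (drop (Suc i) xs))"

lemma split_sum_Nil [simp]: "split_sum h [] = 0"
  by (simp add: split_sum_def)

lemma split_sum_Cons [simp]:
  "split_sum h (x # xs) = h [] x xs + split_sum (\<lambda>l. h (x # l)) xs"
  by (simp add: split_sum_def sum.lessThan_Suc_shift del: sum.lessThan_Suc)

lemma split_sum_append [simp]:
  "split_sum h (A @ B) = split_sum (\<lambda>l x r. h l x (r @ B)) A + split_sum (\<lambda>l. h (A @ l)) B"
  by (induction A arbitrary: h) (simp_all add: add.assoc)

lemma split_sum_add: "split_sum h xs + split_sum h' xs = split_sum (\<lambda>l x r. h l x r + h' l x r) xs"
  by (simp add: split_sum_def sum.distrib)

lemma split_sum_diff:
  fixes h :: "'a list \<Rightarrow> 'a \<Rightarrow> 'a list \<Rightarrow> 'b::ab_group_add"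
  shows "split_sum h xs - split_sum h' xs = split_sum (\<lambda>l x r. h l x r - h' l x r) xs"
  by (simp add: split_sum_def sum_subtractf)

lemma split_sum_minus:
  fixes h :: "'a list \<Rightarrow> 'a \<Rightarrow> 'a list \<Rightarrow> 'b::ab_group_add"
  shows "split_sum (\<lambda>l x r. - h l x r) xs = - split_sum h xs"
  by (simp add: split_sum_def sum_negf)

lemma split_sum_fscale: "fscale c (split_sum h xs) = split_sum (\<lambda>l x r. fscale c (h l x r)) xs"
  by (simp add: split_sum_def fscale.scale_sum_right)

lemma split_sum_linear_ext:
  "linear_ext f (split_sum h xs) = split_sum (\<lambda>l x r. linear_ext f (h l x r)) xs"
  by (simp add: split_sum_def linear_ext.sum)

lemma split_sum_swap:
  "split_sum (\<lambda>l x r. split_sum (\<lambda>l' y r'. h l x r l' y r') ys) xs =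
   split_sum (\<lambda>l' y r'. split_sum (\<lambda>l x r. h l x r l' y r') xs) ys"
  unfolding split_sum_def by (rule sum.swap)

lemma split_sum_const: "split_sum (\<lambda>_ _ _. x) xs = fscale (of_nat (length xs)) x"
  by (induction xs) (simp_all add: fscale.scale_left_distrib)

lemma split_sum_map: "split_sum h (map g xs) = split_sum (\<lambda>l x r. h (map g l) (g x) (map g r)) xs"
  by (simp add: split_sum_def take_map drop_map)

lemma split_sum_in_subspace:
  assumes "module.subspace fscale U" "\<And>l x r. xs = l @ x # r \<Longrightarrow> h l x r \<in> U"
  shows "split_sum h xs \<in> U"
  unfolding split_sum_def
  using assms by (auto intro!: fscale.subspace_sum simp: id_take_nth_drop)

lemma phi_word_split_sum:
  "phi_word (ws, us) = split_sum (\<lambda>l u r. word (ws @ [u]) (l @ r)) us"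
  by (simp add: phi_word_def split_sum_def)

lemma koszul_word_split_sum:
  "koszul_word (ws, us) = split_sum (\<lambda>l w r. fscale ((- 1) ^ length r) (word (l @ r) (w # us))) ws"
  by (simp add: koszul_word_def split_sum_def fscale_single)

section \<open>The maps descend to the tensor products\<close>

lemma subspace_rel_space: "module.subspace fscale (rel_space s)"
  unfolding rel_space_def by (rule fscale.subspace_span)

lemmas rel_space_add = fscale.subspace_add[OF subspace_rel_space]
  and rel_space_scale = fscale.subspace_scale[OF subspace_rel_space]
  and rel_space_diff = fscale.subspace_diff[OF subspace_rel_space]
  and rel_space_0 = fscale.subspace_0[OF subspace_rel_space]
  and rel_space_neg = fscale.subspace_neg[OF subspace_rel_space]

lemma rel_space_relators:
  shows word_wedge_add:
      "word (A @ (x + y) # B) us - word (A @ x # B) us - word (A @ y # B) us \<in> rel_space s"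
    and word_wedge_scale: "word (A @ s c x # B) us - fscale c (word (A @ x # B) us) \<in> rel_space s"
    and word_wedge_alt: "word (A @ x # x # B) us \<in> rel_space s"
    and word_sym_add:
      "word ws (A @ (x + y) # B) - word ws (A @ x # B) - word ws (A @ y # B) \<in> rel_space s"
    and word_sym_scale: "word ws (A @ s c x # B) - fscale c (word ws (A @ x # B)) \<in> rel_space s"
    and word_sym_comm: "word ws (A @ x # y # B) - word ws (A @ y # x # B) \<in> rel_space s"
  using relators.wedge_add[of A x y B us s] relators.wedge_scale[of A s c x B us]
    relators.wedge_alt[of A x B us s] relators.sym_add[of ws A x y B s]
    relators.sym_scale[of ws A s c x B] relators.sym_comm[of ws A x y B s]
  unfolding rel_space_def by (auto intro: fscale.span_base)

text \<open>
  The descent criterion: it suffices to test \<open>f\<close> on the six kinds of relators. They are written with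
  \<open>Cons\<close> in place of singleton lists so that they are normal forms of the simplifier.
\<close>

lemma linear_ext_rel_space:
  fixes s :: "'k::field \<Rightarrow> 'v::ab_group_add \<Rightarrow> 'v"
  assumes wedge_add: "\<And>A x y B us.
      f (A @ (x + y) # B, us) - f (A @ x # B, us) - f (A @ y # B, us) \<in> rel_space s"
    and wedge_scale: "\<And>A c x B us.
      f (A @ s c x # B, us) - fscale c (f (A @ x # B, us)) \<in> rel_space s"
    and wedge_alt: "\<And>A x B us. f (A @ x # x # B, us) \<in> rel_space s"
    and sym_add: "\<And>ws A x y B.
      f (ws, A @ (x + y) # B) - f (ws, A @ x # B) - f (ws, A @ y # B) \<in> rel_space s"
    and sym_scale: "\<And>ws A c x B.
      f (ws, A @ s c x # B) - fscale c (f (ws, A @ x # B)) \<in> rel_space s"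
    and sym_comm: "\<And>ws A x y B. f (ws, A @ x # y # B) - f (ws, A @ y # x # B) \<in> rel_space s"
    and "x \<in> rel_space s"
  shows "linear_ext f x \<in> rel_space s"
proof -
  have "linear_ext f r \<in> rel_space s" if "r \<in> relators s" for r
    using that
    by cases (auto simp: linear_ext.diff linear_ext.scale
        intro: wedge_add wedge_scale wedge_alt sym_add sym_scale sym_comm)
  with assms(7) show ?thesis
    unfolding rel_space_def[of s]
    by (induction rule: fscale.span_induct_alt)
       (auto simp: linear_ext.add linear_ext.scale rel_space_0[unfolded rel_space_def]
         intro!: rel_space_add[unfolded rel_space_def] rel_space_scale[unfolded rel_space_def])
qed

text \<open>
  Additivity and homogeneity modulo \<open>rel_space s\<close> survive addition, scaling and summation over
  splittings, so that they need only be checked on single words.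
\<close>

lemma rel_space_combine:
  shows additive_plus:
      "a - b - c \<in> rel_space s \<Longrightarrow> a' - b' - c' \<in> rel_space s \<Longrightarrow>
       (a + a') - (b + b') - (c + c') \<in> rel_space s"
    and additive_fscale:
      "a - b - c \<in> rel_space s \<Longrightarrow> fscale k a - fscale k b - fscale k c \<in> rel_space s"
    and homogeneous_plus:
      "a - fscale d b \<in> rel_space s \<Longrightarrow> a' - fscale d b' \<in> rel_space s \<Longrightarrow>
       (a + a') - fscale d (b + b') \<in> rel_space s"
    and homogeneous_fscale:
      "a - fscale d b \<in> rel_space s \<Longrightarrow> fscale k a - fscale d (fscale k b) \<in> rel_space s"
    and congruent_plus:
      "a - b \<in> rel_space s \<Longrightarrow> a' - b' \<in> rel_space s \<Longrightarrow> (a + a') - (b + b') \<in> rel_space s"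
    and congruent_fscale: "a - b \<in> rel_space s \<Longrightarrow> fscale k a - fscale k b \<in> rel_space s"
proof -
  show "(a + a') - (b + b') - (c + c') \<in> rel_space s"
    if "a - b - c \<in> rel_space s" "a' - b' - c' \<in> rel_space s"
    using rel_space_add[OF that] by (simp add: algebra_simps)
  show "fscale k a - fscale k b - fscale k c \<in> rel_space s" if "a - b - c \<in> rel_space s"
    using rel_space_scale[OF that, of k] by (simp add: fscale.scale_right_diff_distrib)
  show "(a + a') - fscale d (b + b') \<in> rel_space s"
    if "a - fscale d b \<in> rel_space s" "a' - fscale d b' \<in> rel_space s"
    using rel_space_add[OF that] by (simp add: fscale.scale_right_distrib algebra_simps)
  show "fscale k a - fscale d (fscale k b) \<in> rel_space s" if "a - fscale d b \<in> rel_space s"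
    using rel_space_scale[OF that, of k] by (simp add: fscale.scale_right_diff_distrib mult.commute)
  show "(a + a') - (b + b') \<in> rel_space s" if "a - b \<in> rel_space s" "a' - b' \<in> rel_space s"
    using rel_space_add[OF that] by (simp add: algebra_simps)
  show "fscale k a - fscale k b \<in> rel_space s" if "a - b \<in> rel_space s"
    using rel_space_scale[OF that, of k] by (simp add: fscale.scale_right_diff_distrib)
qed

lemma rel_space_split_sum:
  shows additive_split_sum:
      "(\<And>l x r. f l x r - g l x r - h l x r \<in> rel_space s) \<Longrightarrow>
       split_sum f xs - split_sum g xs - split_sum h xs \<in> rel_space s"
    and homogeneous_split_sum:
      "(\<And>l x r. f l x r - fscale c (g l x r) \<in> rel_space s) \<Longrightarrow>
       split_sum f xs - fscale c (split_sum g xs) \<in> rel_space s"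
    and congruent_split_sum:
      "(\<And>l x r. xs = l @ x # r \<Longrightarrow> f l x r - g l x r \<in> rel_space s) \<Longrightarrow>
       split_sum f xs - split_sum g xs \<in> rel_space s"
  by (auto simp only: split_sum_diff split_sum_fscale
      intro!: split_sum_in_subspace subspace_rel_space)

lemmas rel_space_intros = rel_space_combine rel_space_split_sum rel_space_relators
  rel_space_add rel_space_scale rel_space_0 split_sum_in_subspace[OF subspace_rel_space]

text \<open>
  When \<open>\<phi>\<close> moves a letter \<open>u\<close>, a relator in the remaining letters is again a relator. If \<open>u\<close> is
  itself the letter \<open>x + y\<close> or \<open>s c x\<close> of a symmetric relator, the result is an exterior relator;
  in the commutativity relator the terms in which \<open>x\<close> or \<open>y\<close> moves cancel in pairs.
\<close>

lemma phi_rel_space: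
  fixes s :: "'k::field \<Rightarrow> 'v::ab_group_add \<Rightarrow> 'v"
  assumes "x \<in> rel_space s"
  shows "linear_ext phi_word x \<in> rel_space s"
proof (rule linear_ext_rel_space[OF _ _ _ _ _ _ assms])
  note [simp] = phi_word_split_sum
  fix A B us ws :: "'v list" and x y c
  show "phi_word (A @ (x + y) # B, us) - phi_word (A @ x # B, us) - phi_word (A @ y # B, us)
      \<in> rel_space s"
    by (auto intro!: rel_space_intros)
  show "phi_word (A @ s c x # B, us) - fscale c (phi_word (A @ x # B, us)) \<in> rel_space s"
    by (auto intro!: rel_space_intros)
  show "phi_word (A @ x # x # B, us) \<in> rel_space s"
    by (auto intro!: rel_space_intros)
  have "word W (l @ r @ (x + y) # B) - word W (l @ r @ x # B) - word W (l @ r @ y # B)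
      \<in> rel_space s" for W l r
    using word_sym_add[of W "l @ r"] by simp
  then show "phi_word (ws, A @ (x + y) # B) - phi_word (ws, A @ x # B) - phi_word (ws, A @ y # B)
      \<in> rel_space s"
    by (auto intro!: rel_space_intros)
  have "word W (l @ r @ s c x # B) - fscale c (word W (l @ r @ x # B)) \<in> rel_space s" for W l r
    using word_sym_scale[of W "l @ r"] by simp
  then show "phi_word (ws, A @ s c x # B) - fscale c (phi_word (ws, A @ x # B)) \<in> rel_space s"
    by (auto intro!: rel_space_intros)
  have "word W (l @ r @ x # y # B) - word W (l @ r @ y # x # B) \<in> rel_space s" for W l r
    using word_sym_comm[of W "l @ r"] by simp
  then have "split_sum (\<lambda>l u r. word (ws @ [u]) (l @ r @ x # y # B)) A -
      split_sum (\<lambda>l u r. word (ws @ [u]) (l @ r @ y # x # B)) A \<in> rel_space s" (is "?a - ?a' \<in> _")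
    by (auto intro!: rel_space_intros)
  moreover have "split_sum (\<lambda>l u r. word (ws @ [u]) (A @ x # y # l @ r)) B -
      split_sum (\<lambda>l u r. word (ws @ [u]) (A @ y # x # l @ r)) B \<in> rel_space s" (is "?b - ?b' \<in> _")
    by (auto intro!: rel_space_intros)
  ultimately have "?a - ?a' + (?b - ?b') \<in> rel_space s"
    by (rule rel_space_add)
  then show "phi_word (ws, A @ x # y # B) - phi_word (ws, A @ y # x # B) \<in> rel_space s"
    by (simp add: algebra_simps)
qed

text \<open>
  As for \<open>\<phi>\<close>, with the lists exchanged. In the relator for \<open>x \<and> x\<close> the two terms that move \<open>x\<close>
  cancel because their signs differ.
\<close>

lemma koszul_rel_space:
  fixes s :: "'k::field \<Rightarrow> 'v::ab_group_add \<Rightarrow> 'v"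
  assumes "x \<in> rel_space s"
  shows "linear_ext koszul_word x \<in> rel_space s"
proof (rule linear_ext_rel_space[OF _ _ _ _ _ _ assms])
  note [simp] = koszul_word_split_sum
  fix A B us ws :: "'v list" and x y c
  have *: "word (l @ r @ (x + y) # B) U - word (l @ r @ x # B) U - word (l @ r @ y # B) U
      \<in> rel_space s" for U l r
    using word_wedge_add[of "l @ r"] by simp
  have **: "word W ((x + y) # us) - word W (x # us) - word W (y # us) \<in> rel_space s" for W
    using word_sym_add[of W "[]"] by simp
  show "koszul_word (A @ (x + y) # B, us) - koszul_word (A @ x # B, us) -
      koszul_word (A @ y # B, us) \<in> rel_space s"
    by (simp del: power_Suc fscale.scale_minus_left, intro additive_plus additive_fscale additive_split_sum word_wedge_add * **)
  have *: "word (l @ r @ s c x # B) U - fscale c (word (l @ r @ x # B) U) \<in> rel_space s" for U l r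
    using word_wedge_scale[of "l @ r"] by simp
  have **: "word W (s c x # us) - fscale c (word W (x # us)) \<in> rel_space s" for W
    using word_sym_scale[of W "[]"] by simp
  show "koszul_word (A @ s c x # B, us) - fscale c (koszul_word (A @ x # B, us)) \<in> rel_space s"
    by (simp del: power_Suc fscale.scale_minus_left fscale.scale_scale,
        intro homogeneous_plus homogeneous_fscale homogeneous_split_sum word_wedge_scale * **)
  have "word (l @ r @ x # x # B) U \<in> rel_space s" for U l r
    using word_wedge_alt[of "l @ r"] by simp
  then have "split_sum (\<lambda>l w r. fscale ((- 1) ^ (length r + Suc (Suc (length B))))
        (word (l @ r @ x # x # B) (w # us))) A +
      split_sum (\<lambda>l w r. fscale ((- 1) ^ length r) (word (A @ x # x # l @ r) (w # us))) B
      \<in> rel_space s"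
    by (auto simp del: power_Suc intro!: rel_space_intros)
  then show "koszul_word (A @ x # x # B, us) \<in> rel_space s"
    by simp
  have "word W (w # A @ (x + y) # B) - word W (w # A @ x # B) - word W (w # A @ y # B)
      \<in> rel_space s" for W w
    using word_sym_add[of W "w # A"] by simp
  then show "koszul_word (ws, A @ (x + y) # B) - koszul_word (ws, A @ x # B) -
      koszul_word (ws, A @ y # B) \<in> rel_space s"
    by (auto intro!: rel_space_intros)
  have "word W (w # A @ s c x # B) - fscale c (word W (w # A @ x # B)) \<in> rel_space s" for W w
    using word_sym_scale[of W "w # A"] by simp
  then show "koszul_word (ws, A @ s c x # B) - fscale c (koszul_word (ws, A @ x # B))
      \<in> rel_space s"
    by (auto intro!: rel_space_intros)
  have "word W (w # A @ x # y # B) - word W (w # A @ y # x # B) \<in> rel_space s" for W w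
    using word_sym_comm[of W "w # A"] by simp
  then show "koszul_word (ws, A @ x # y # B) - koszul_word (ws, A @ y # x # B) \<in> rel_space s"
    by (auto intro!: rel_space_intros)
qed

lemma act_rel_space:
  assumes "Vector_Spaces.linear s s g" "x \<in> rel_space s"
  shows "linear_ext (act_word g) x \<in> rel_space s"
proof -
  interpret g: Vector_Spaces.linear s s g by fact
  show ?thesis
    by (rule linear_ext_rel_space[OF _ _ _ _ _ _ assms(2)])
       (auto simp: act_word_def g.add g.scale intro!: rel_space_relators)
qed

section \<open>The maps on words commute with the group action\<close>

lemma phi_act:
  fixes x :: "('v, 'k::field) words"
  shows "linear_ext phi_word (linear_ext (act_word g) x) = linear_ext (act_word g) (linear_ext phi_word x)"
proof -
  have "linear_ext phi_word (act_word g w :: ('v, 'k) words) = linear_ext (act_word g) (phi_word w)" for w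
    by (cases w) (simp add: act_word_def phi_word_split_sum split_sum_map split_sum_linear_ext)
  then show ?thesis
    by (simp add: linear_ext_linear_ext)
qed

lemma koszul_act:
  fixes x :: "('v, 'k::field) words"
  shows "linear_ext koszul_word (linear_ext (act_word g) x) =
   linear_ext (act_word g) (linear_ext koszul_word x)"
proof -
  have "linear_ext koszul_word (act_word g w :: ('v, 'k) words) = linear_ext (act_word g) (koszul_word w)" for w
    by (cases w)
       (simp add: act_word_def koszul_word_split_sum split_sum_map split_sum_linear_ext
         linear_ext.scale)
  then show ?thesis
    by (simp add: linear_ext_linear_ext)
qed

section \<open>The homotopy identity\<close>

text \<open>
  Expand \<open>(x + y) \<and> (x + y) = 0\<close>, using \<open>x \<and> x = y \<and> y = 0\<close>.
\<close>

lemma wedge_swap: "word (A @ x # y # B) us + word (A @ y # x # B) us \<in> rel_space s"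
proof -
  let ?w = "\<lambda>a b. word (A @ a # b # B) us"
  have a: "?w (x + y) (x + y) - ?w x (x + y) - ?w y (x + y) \<in> rel_space s"
    by (rule word_wedge_add)
  have b: "?w z (x + y) - ?w z x - ?w z y \<in> rel_space s" for z
    using word_wedge_add[of "A @ [z]"] by simp
  have "?w (x + y) (x + y) - ?w x x - ?w y y -
      ((?w (x + y) (x + y) - ?w x (x + y) - ?w y (x + y)) +
       ((?w x (x + y) - ?w x x - ?w x y) + (?w y (x + y) - ?w y x - ?w y y))) \<in> rel_space s"
    by (intro rel_space_diff rel_space_add a b word_wedge_alt)
  then show ?thesis
    by (simp add: algebra_simps)
qed

lemma wedge_move_last:
  "fscale ((- 1) ^ length r) (word (l @ r @ [w]) us) - word (l @ w # r) us \<in> rel_space s"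
proof (induction r arbitrary: l)
  case (Cons a r)
  have "- (fscale ((- 1) ^ length r) (word ((l @ [a]) @ r @ [w]) us) - word ((l @ [a]) @ w # r) us) -
      (word (l @ w # a # r) us + word (l @ a # w # r) us) \<in> rel_space s"
    by (intro rel_space_diff rel_space_neg Cons.IH wedge_swap)
  then show ?case
    by (simp add: fscale.scale_minus_left)
qed (simp add: rel_space_0)

lemma sym_move_first: "word ws (u # l @ r) - word ws (l @ u # r) \<in> rel_space s"
proof (induction l arbitrary: r rule: rev_induct)
  case (snoc a l)
  have "(word ws (u # l @ a # r) - word ws (l @ u # a # r)) +
      (word ws (l @ u # a # r) - word ws (l @ a # u # r)) \<in> rel_space s"
    by (intro rel_space_add snoc.IH word_sym_comm)
  then show ?case
    by simp
qed (simp add: rel_space_0)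

text \<open>
  In \<open>\<phi> \<kappa> + \<kappa> \<phi>\<close> the terms that move one letter in each direction cancel, because \<open>\<phi>\<close> lengthens
  the exterior word and so changes every sign of \<open>\<kappa>\<close>. What remains are the terms in which one
  letter is moved away and back, one for each of the letters; each of them is the identity.
\<close>

lemma homotopy_word:
  fixes s :: "'k::field \<Rightarrow> 'v::ab_group_add \<Rightarrow> 'v"
  shows "linear_ext phi_word (koszul_word (ws, us)) + linear_ext koszul_word (phi_word (ws, us)) -
   fscale (of_nat (length ws + length us)) (word ws us) \<in> rel_space s"
proof -
  let ?both = "split_sum (\<lambda>l w r. split_sum (\<lambda>l' u r'.
      fscale ((- 1) ^ length r) (word (l @ r @ [u]) (w # l' @ r'))) us) ws :: ('v, 'k) words"
  let ?P = "split_sum (\<lambda>l w r. fscale ((- 1) ^ length r) (word (l @ r @ [w]) us)) ws :: ('v, 'k) words"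
  let ?Q = "split_sum (\<lambda>l u r. word ws (u # l @ r)) us :: ('v, 'k) words"
  have "linear_ext phi_word (koszul_word (ws, us)) = ?P + ?both"
    by (simp add: koszul_word_split_sum phi_word_split_sum split_sum_linear_ext linear_ext.scale
        split_sum_add fscale.scale_right_distrib split_sum_fscale)
  \<comment> \<open>\<open>?Q\<close> collects the terms in which \<open>\<kappa>\<close> takes back the letter that \<open>\<phi>\<close> has just put last,
    which costs no sign.\<close>
  moreover have "linear_ext koszul_word (phi_word (ws, us)) = ?Q - ?both"
    by (subst split_sum_swap)
       (simp add: koszul_word_split_sum phi_word_split_sum split_sum_linear_ext split_sum_diff
         split_sum_add[symmetric] split_sum_minus)
  ultimately have "linear_ext phi_word (koszul_word (ws, us)) +
      linear_ext koszul_word (phi_word (ws, us)) = ?P + ?Q"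
    by simp
  moreover have "?P - split_sum (\<lambda>l w r. word ws us) ws \<in> rel_space s"
    using wedge_move_last by (intro congruent_split_sum) auto
  moreover have "?Q - split_sum (\<lambda>l w r. word ws us) us \<in> rel_space s"
    using sym_move_first by (intro congruent_split_sum) auto
  ultimately show ?thesis
    using congruent_plus
    by (simp only: split_sum_const fscale.scale_left_distrib of_nat_add)
qed

lemma word_space_iff:
  "x \<in> word_space b a \<longleftrightarrow>
   (\<forall>ws us. (ws, us) \<in> Poly_Mapping.keys x \<longrightarrow> int (length ws) = b \<and> int (length us) = a)"
  by (auto simp: word_space_def)

text \<open>
  By linearity the homotopy identity extends from words to all of \<open>word_space b a\<close>, where every word
  has the same total length \<open>b + a\<close>. The characteristic of the field enters only through the
  vanishing of this scalar.
\<close>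

lemma phi_koszul_anticommute:
  fixes s :: "'k::field \<Rightarrow> 'v::ab_group_add \<Rightarrow> 'v"
  assumes "x \<in> word_space b a" "of_int (b + a) = (0 :: 'k)"
  shows "linear_ext phi_word (linear_ext koszul_word x) +
    linear_ext koszul_word (linear_ext phi_word x) \<in> rel_space s"
  unfolding linear_ext_linear_ext linear_ext_add_maps
proof (rule linear_ext_in_subspace[OF subspace_rel_space])
  fix w :: "'v list \<times> 'v list"
  assume w: "w \<in> Poly_Mapping.keys x"
  obtain ws us where "w = (ws, us)"
    by fastforce
  moreover from this w assms(1) have "b + a = int (length ws + length us)"
    by (auto simp: word_space_iff)
  with assms(2) have "of_nat (length ws + length us) = (0 :: 'k)"
    by (metis of_int_of_nat_eq)
  ultimately show "linear_ext phi_word (koszul_word w) + linear_ext koszul_word (phi_word w)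
      \<in> rel_space s"
    using homotopy_word[of ws us s] by simp
qed

section \<open>Graded pieces\<close>

lemma subspace_word_space: "module.subspace fscale (word_space b a)"
proof (rule fscale.subspaceI)
  show "0 \<in> word_space b a"
    by (simp add: word_space_iff)
  show "x + y \<in> word_space b a" if "x \<in> word_space b a" "y \<in> word_space b a" for x y
    using that keys_add[of x y] unfolding word_space_iff by blast
  show "fscale c x \<in> word_space b a" if "x \<in> word_space b a" for c x
    using that by (auto simp: word_space_iff in_keys_iff)
qed

lemma linear_ext_word_space:
  assumes "x \<in> word_space b a"
    and "\<And>ws us. int (length ws) = b \<Longrightarrow> int (length us) = a \<Longrightarrow> f (ws, us) \<in> word_space b' a'"
  shows "linear_ext f x \<in> word_space b' a'"
  using assms(1)[unfolded word_space_iff]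
  by (intro linear_ext_in_subspace subspace_word_space) (auto intro: assms(2))

lemma word_in_word_space:
  "int (length ws) = b \<Longrightarrow> int (length us) = a \<Longrightarrow> word ws us \<in> word_space b a"
  by (auto simp: word_space_iff)

lemma phi_word_space:
  assumes "x \<in> word_space b a"
  shows "linear_ext phi_word x \<in> word_space (b + 1) (a - 1)"
  using assms
  by (rule linear_ext_word_space)
     (auto simp: phi_word_split_sum intro!: split_sum_in_subspace subspace_word_space word_in_word_space)

lemma act_word_space:
  assumes "x \<in> word_space b a"
  shows "linear_ext (act_word g) x \<in> word_space b a"
  using assms
  by (rule linear_ext_word_space) (auto simp: act_word_def intro!: word_in_word_space)

section \<open>Induced maps on cosets\<close>

text \<open>
  In place of subgroups it is enough that \<open>H'\<close> contains \<open>f ` H\<close>, is closed under addition, and that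
  some \<open>f e\<close> with \<open>e \<in> H\<close> acts as zero on \<open>H'\<close>. This generality covers
  the quotient by \<open>rel_space s\<close> and also the quotient by \<open>hook_rel s a b\<close>, where the elements are
  cosets themselves, which form a group whose zero is \<open>rel_space s\<close> and not the zero of the
  ambient monoid of sets.
\<close>

lemma induced_coset:
  fixes f :: "'x::plus \<Rightarrow> 'y::comm_monoid_add"
  assumes add: "\<And>h. h \<in> H \<Longrightarrow> f (x + h) = f x + f h"
    and sub: "f ` H \<subseteq> H'"
    and closed: "\<And>a b. a \<in> H' \<Longrightarrow> b \<in> H' \<Longrightarrow> a + b \<in> H'"
    and e: "e \<in> H" "\<And>b. b \<in> H' \<Longrightarrow> f e + b = b"
  shows "induced f H' (x +o H) = f x +o H'"
proof (rule set_eqI)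
  fix z
  have "z \<in> induced f H' (x +o H) \<longleftrightarrow> (\<exists>h\<in>H. \<exists>b\<in>H'. z = f (x + h) + b)"
    by (auto simp: induced_def set_plus_def elt_set_plus_def)
  also have "\<dots> \<longleftrightarrow> (\<exists>h\<in>H. \<exists>b\<in>H'. z = f x + (f h + b))"
    by (simp add: add add.assoc)
  also have "\<dots> \<longleftrightarrow> (\<exists>b\<in>H'. z = f x + b)"
    using sub closed e by (metis image_subset_iff)
  finally show "z \<in> induced f H' (x +o H) \<longleftrightarrow> z \<in> f x +o H'"
    by (auto simp: elt_set_plus_def)
qed

lemma induced_class:
  assumes "\<And>r. r \<in> rel_space s \<Longrightarrow> linear_ext f r \<in> rel_space s"
  shows "induced (linear_ext f) (rel_space s) (x +o rel_space s) = linear_ext f x +o rel_space s"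
  using assms
  by (intro induced_coset[where e = 0])
     (auto simp: linear_ext.add linear_ext.zero rel_space_0 intro: rel_space_add)

lemma class_add: "(x +o rel_space s) + (y +o rel_space s) = (x + y) +o rel_space s"
proof -
  have "rel_space s + rel_space s = rel_space s"
    using rel_space_0[of s] by (auto simp: set_plus_def intro: rel_space_add) (metis add.right_neutral)
  then show ?thesis
    by (simp add: set_plus_rearrange)
qed

lemma class_eqI:
  assumes "x - y \<in> rel_space s"
  shows "x +o rel_space s = y +o rel_space s"
proof (intro set_eqI iffI)
  fix z
  show "z \<in> y +o rel_space s" if "z \<in> x +o rel_space s"
    using that rel_space_add[OF assms, of "z - x"] by (auto simp: set_minus_plus[symmetric])
  show "z \<in> x +o rel_space s" if "z \<in> y +o rel_space s"
    using that rel_space_diff[OF _ assms, of "z - y"] by (auto simp: set_minus_plus[symmetric])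
qed

lemma hook_rel_eq:
  "hook_rel s a b =
   (\<lambda>y. linear_ext koszul_word y +o rel_space s) ` word_space (b + 2) (a - 2)"
  by (simp add: hook_rel_def ext_sym_def koszul_def image_image induced_class koszul_rel_space)

lemma hook_schur_eq:
  "hook_schur s a b =
   (\<lambda>x. (x +o rel_space s) +o hook_rel s a b) ` word_space (b + 1) (a - 1)"
  by (simp add: hook_schur_def ext_sym_def image_image)

text \<open>
  The criterion for the second quotient. The image of \<open>\<kappa>\<close> need only be preserved modulo
  \<open>rel_space s\<close>, because \<open>hook_rel\<close> consists of classes modulo \<open>rel_space s\<close>; the homotopy
  identity gives no more than that.
\<close>

lemma induced_hook_class:
  assumes desc: "\<And>r. r \<in> rel_space s \<Longrightarrow> linear_ext f r \<in> rel_space s"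
    and image: "\<And>y. y \<in> word_space (b + 2) (a - 2) \<Longrightarrow>
      \<exists>z\<in>word_space (b' + 2) (a' - 2).
        linear_ext f (linear_ext koszul_word y) - linear_ext koszul_word z \<in> rel_space s"
  shows "induced (induced (linear_ext f) (rel_space s)) (hook_rel s a' b')
      ((x +o rel_space s) +o hook_rel s a b) =
    (linear_ext f x +o rel_space s) +o hook_rel s a' b'"
proof -
  note ind = induced_class[OF desc]
  have "induced (induced (linear_ext f) (rel_space s)) (hook_rel s a' b')
      ((x +o rel_space s) +o hook_rel s a b) =
    induced (linear_ext f) (rel_space s) (x +o rel_space s) +o hook_rel s a' b'"
  proof (rule induced_coset[where e = "0 +o rel_space s"])
    show "induced (linear_ext f) (rel_space s) ((x +o rel_space s) + h) =
        induced (linear_ext f) (rel_space s) (x +o rel_space s) +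
        induced (linear_ext f) (rel_space s) h" if "h \<in> hook_rel s a b" for h
      using that by (auto simp: hook_rel_eq class_add ind linear_ext.add)
    show "induced (linear_ext f) (rel_space s) ` hook_rel s a b \<subseteq> hook_rel s a' b'"
    proof
      fix h
      assume "h \<in> induced (linear_ext f) (rel_space s) ` hook_rel s a b"
      then obtain y where "y \<in> word_space (b + 2) (a - 2)"
        and h: "h = linear_ext f (linear_ext koszul_word y) +o rel_space s"
        by (auto simp: hook_rel_eq ind)
      then show "h \<in> hook_rel s a' b'"
        using image[of y] class_eqI by (fastforce simp: hook_rel_eq)
    qed
    show "u + v \<in> hook_rel s a' b'" if uv: "u \<in> hook_rel s a' b'" "v \<in> hook_rel s a' b'" for u v
    proof -
      obtain y z where "y \<in> word_space (b' + 2) (a' - 2)" "z \<in> word_space (b' + 2) (a' - 2)"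
        and "u + v = linear_ext koszul_word (y + z) +o rel_space s"
        using uv by (auto simp: hook_rel_eq class_add linear_ext.add)
      then show ?thesis
        unfolding hook_rel_eq
        by (metis (no_types, lifting) fscale.subspace_add[OF subspace_word_space] imageI)
    qed
    have "0 +o rel_space s = linear_ext koszul_word 0 +o rel_space s"
      by (simp add: linear_ext.zero)
    then show "0 +o rel_space s \<in> hook_rel s a b"
      unfolding hook_rel_eq using fscale.subspace_0[OF subspace_word_space] by blast
    show "induced (linear_ext f) (rel_space s) (0 +o rel_space s) + v = v"
      if "v \<in> hook_rel s a' b'" for v
      using that by (auto simp: hook_rel_eq ind class_add linear_ext.zero simp del: set_zero_plus)
  qed
  then show ?thesis
    by (simp only: ind)
qed

lemma N_act_class:
  fixes s :: "'k::field \<Rightarrow> 'v::ab_group_add \<Rightarrow> 'v"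
  assumes "g \<in> GL s"
  shows "N_act s m i g ((x +o rel_space s) +o hook_rel s (int m - int i) (int i)) =
    (linear_ext (act_word g) x +o rel_space s) +o hook_rel s (int m - int i) (int i)"
  unfolding N_act_def hook_act_def act_def
proof (rule induced_hook_class)
  show "linear_ext (act_word g) r \<in> rel_space s" if "r \<in> rel_space s" for r
    using assms that by (auto simp: GL_def intro: act_rel_space)
  show "\<exists>z\<in>word_space (int i + 2) (int m - int i - 2).
      linear_ext (act_word g) (linear_ext koszul_word y) - linear_ext koszul_word z \<in> rel_space s"
    if "y \<in> word_space (int i + 2) (int m - int i - 2)" for y :: "('v, 'k) words"
    using act_word_space[OF that, of g]
    by (intro bexI[of _ "linear_ext (act_word g) y"]) (simp_all add: koszul_act rel_space_0)
qed

lemma N_diff_class: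
  fixes s :: "'k::field \<Rightarrow> 'v::ab_group_add \<Rightarrow> 'v"
  assumes "CHAR('k) dvd m"
  shows "N_diff s m i ((x +o rel_space s) +o hook_rel s (int m - int i) (int i)) =
    (linear_ext phi_word x +o rel_space s) +o hook_rel s (int m - int i - 1) (int i + 1)"
  unfolding N_diff_def phi_def
proof (rule induced_hook_class)
  show "linear_ext phi_word r \<in> rel_space s" if "r \<in> rel_space s" for r
    using that by (rule phi_rel_space)
  fix y :: "('v, 'k) words"
  assume y: "y \<in> word_space (int i + 2) (int m - int i - 2)"
  have "of_nat m = (0 :: 'k)"
    using assms by (simp add: of_nat_eq_0_iff_char_dvd)
  then have "linear_ext phi_word (linear_ext koszul_word y) +
      linear_ext koszul_word (linear_ext phi_word y) \<in> rel_space s"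
    by (intro phi_koszul_anticommute[OF y]) simp
  moreover have "- linear_ext phi_word y \<in> word_space (int i + 1 + 2) (int m - int i - 1 - 2)"
    using fscale.subspace_neg[OF subspace_word_space phi_word_space[OF y]]
    by (simp add: algebra_simps)
  ultimately show "\<exists>z\<in>word_space (int i + 1 + 2) (int m - int i - 1 - 2).
      linear_ext phi_word (linear_ext koszul_word y) - linear_ext koszul_word z \<in> rel_space s"
    by (auto simp: linear_ext.neg intro!: bexI[of _ "- linear_ext phi_word y"])
qed

theorem proposition3p9:
  fixes scale :: "'k::field \<Rightarrow> 'v::ab_group_add \<Rightarrow> 'v"
    and Basis :: "'v set" and p m :: nat
  assumes "finite_dimensional_vector_space scale Basis"
    and "CHAR('k) = p" and "p > 0"
    and "m > 0" and "p dvd m"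
  shows "\<forall>i. i + 1 < m \<longrightarrow>
    equivariant (GL scale) (N_term scale m i) (N_act scale m i)
      (N_term scale m (i + 1)) (N_act scale m (i + 1)) (N_diff scale m i)"
proof (intro allI impI)
  fix i
  let ?hook = "\<lambda>i x. (x +o rel_space scale) +o hook_rel scale (int m - int i) (int i)"
  have N_term: "N_term scale m j = ?hook j ` word_space (int j + 1) (int m - int j - 1)" for j
    by (simp add: N_term_def hook_schur_eq)
  have act: "N_act scale m j g (?hook j x) = ?hook j (linear_ext (act_word g) x)"
    if "g \<in> GL scale" for j g x
    using that by (rule N_act_class)
  have diff: "N_diff scale m i (?hook i x) = ?hook (i + 1) (linear_ext phi_word x)" for x
    using N_diff_class[of m scale i x] assms by (simp add: algebra_simps)
  show "equivariant (GL scale) (N_term scale m i) (N_act scale m i)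
      (N_term scale m (i + 1)) (N_act scale m (i + 1)) (N_diff scale m i)"
    unfolding equivariant_def
  proof (intro conjI ballI)
    fix X
    assume "X \<in> N_term scale m i"
    then obtain x where x: "x \<in> word_space (int i + 1) (int m - int i - 1)" and X: "X = ?hook i x"
      by (auto simp: N_term)
    have "linear_ext phi_word x \<in> word_space (int (i + 1) + 1) (int m - int (i + 1) - 1)"
      using phi_word_space[OF x] by (simp add: algebra_simps)
    then show "N_diff scale m i X \<in> N_term scale m (i + 1)"
      unfolding X diff N_term by (rule imageI)
    fix g
    assume g: "g \<in> GL scale"
    show "N_diff scale m i (N_act scale m i g X) = N_act scale m (i + 1) g (N_diff scale m i X)"
      by (simp only: X act[OF g] diff phi_act)
  qed
qed

end
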